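(* Let $\mathcal{R}$ be the set of all curves $\mathcal{C}\subset\mathbb{R}^2$ for which there exist an integer $n\ge3$, an integer $m\ge0$, $\rho>0$ and real coefficients such that $\mathcal{C}$ is parametrized by $\theta\in[-\pi,\pi]\mapsto\big(p(\theta)\cos\theta-p'(\theta)\sin\theta,\ p(\theta)\sin\theta+p'(\theta)\cos\theta\big)$ with $$p(\theta)=\rho+\sum_{k=0}^{m}\big(a_{kn+1}\cos(kn+1)\theta+b_{kn+1}\sin(kn+1)\theta+a_{kn-1}\cos(kn-1)\theta+b_{kn-1}\sin(kn-1)\theta\big)$$ and $p+p''\geq0$ on $\mathbb{R}$. Then the minimum, over all curves in $\mathcal{R}$ that are not circles, of the total degree of the defining polynomial of the curve equals $6$.
   Context: The defining polynomial of the curve $\mathcal{C}$ is the irreducible polynomial $f\in\mathbb{R}[x,y]$, unique up to a nonzero constant factor, whose zero set is the Zariski closure of $\mathcal{C}$. *)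

theory Defs
  imports "HOL-Analysis.Analysis" "HOL-Computational_Algebra.Polynomial_Factorial"
begin

text \<open>Bivariate real polynomials f in R[x,y] are represented as elements of R[x][y],
  i.e. type real poly poly: f = sum_j c_j(x) y^j.\<close>

definition eval2 :: "real poly poly \<Rightarrow> real \<times> real \<Rightarrow> real" where
  "eval2 f q = poly (map_poly (\<lambda>c. poly c (fst q)) f) (snd q)"

definition total_degree :: "real poly poly \<Rightarrow> nat" where
  "total_degree f = Max ({i + j | i j. coeff (coeff f j) i \<noteq> 0} \<union> {0})"

definition zero_set :: "real poly poly \<Rightarrow> (real \<times> real) set" where
  "zero_set f = {q. eval2 f q = 0}"

definition zariski_closure :: "(real \<times> real) set \<Rightarrow> (real \<times> real) set" where
  "zariski_closure S = {q. \<forall>g. (\<forall>s\<in>S. eval2 g s = 0) \<longrightarrow> eval2 g q = 0}"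

definition defining_poly :: "real poly poly \<Rightarrow> (real \<times> real) set \<Rightarrow> bool" where
  "defining_poly f C \<longleftrightarrow> irreducible f \<and> zero_set f = zariski_closure C"

definition supp_fun :: "nat \<Rightarrow> nat \<Rightarrow> real \<Rightarrow> (int \<Rightarrow> real) \<Rightarrow> (int \<Rightarrow> real) \<Rightarrow> real \<Rightarrow> real" where
  "supp_fun n m \<rho> a b \<theta> = \<rho> + (\<Sum>k=0..m.
      a (int (k*n) + 1) * cos (of_int (int (k*n) + 1) * \<theta>)
    + b (int (k*n) + 1) * sin (of_int (int (k*n) + 1) * \<theta>)
    + a (int (k*n) - 1) * cos (of_int (int (k*n) - 1) * \<theta>)
    + b (int (k*n) - 1) * sin (of_int (int (k*n) - 1) * \<theta>))"

definition curve_of :: "(real \<Rightarrow> real) \<Rightarrow> (real \<times> real) set" where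
  "curve_of p = (\<lambda>\<theta>. (p \<theta> * cos \<theta> - deriv p \<theta> * sin \<theta>,
                        p \<theta> * sin \<theta> + deriv p \<theta> * cos \<theta>)) ` {-pi..pi}"

definition in_R :: "(real \<times> real) set \<Rightarrow> bool" where
  "in_R C \<longleftrightarrow> (\<exists>n m \<rho> a b. n \<ge> 3 \<and> \<rho> > 0 \<and>
      (\<forall>\<theta>. supp_fun n m \<rho> a b \<theta> + deriv (deriv (supp_fun n m \<rho> a b)) \<theta> \<ge> 0) \<and>
      C = curve_of (supp_fun n m \<rho> a b))"

definition is_circle :: "(real \<times> real) set \<Rightarrow> bool" where
  "is_circle C \<longleftrightarrow> (\<exists>x0 y0 r. r > 0 \<and> C = {q. (fst q - x0)^2 + (snd q - y0)^2 = r^2})"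

end

theory Submission
  imports Defs
begin

text \<open>
  With $t = e^{i\theta}$ and the translation removed, a curve in the class is
  $z = \rho t + \sum_{j=2}^N ((1-j) c_j t^{j+1} + (1+j) \bar c_j t^{1-j})$, where $c_N \neq 0$
  and $N \ge 2$ unless the curve is a circle. A polynomial vanishing on the curve is a relation
  between $z$ and $w = \bar z$. As $t \to \infty$ these have orders $N+1$ and $N-1$, so the terms
  $z^i w^j$ of maximal weight $(N+1)i + (N-1)j$ cancel. Two such terms differ by at least 3 in $j$,
  except when $N = 3$; then 3 is the only frequency above 1, and $\rho \neq 0$ yields a
  second cancellation with the same effect. By conjugation the same holds with $z$ and $w$
  exchanged, and convexity of the Newton polygon produces a term with $i, j \ge 3$.

  The support function $(3 + \cos 2\theta)/2$ gives the curve $x = 3c - c^3$, $y = s^3$ with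
  $c = \cos\theta$, $s = \sin\theta$, on which $(4 - x^2 - y^2)^3 = 27 y^4$. The functions
  $1, y, \dots, y^5$ on it are linearly independent over the polynomials in $x$, and the sextic is
  monic in $y$ up to sign, so it divides every polynomial vanishing on the curve.
\<close>

section \<open>Vanishing criteria and evaluation of bivariate polynomials\<close>

lemma poly_eq_0_on_infinite:
  fixes p :: "'a::{comm_ring_1,ring_no_zero_divisors} poly"
  assumes "infinite A" "\<And>x. x \<in> A \<Longrightarrow> poly p x = 0"
  shows "p = 0"
proof (rule ccontr)
  assume "p \<noteq> 0"
  then have "finite {x. poly p x = 0}" by (rule poly_roots_finite)
  moreover have "A \<subseteq> {x. poly p x = 0}" using assms(2) by auto
  ultimately show False using assms(1) finite_subset by blast
qed

text \<open>Turns an identity valid for all angles into one between polynomials in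
  \<open>cis \<theta>\<close>, whose coefficients can then be compared.\<close>

lemma poly_eq_0_on_circle:
  assumes "\<And>\<theta>. \<theta> \<in> {-pi..pi} \<Longrightarrow> poly p (cis \<theta>) = 0"
  shows "p = 0"
proof (rule poly_eq_0_on_infinite)
  have "inj_on cis {0..pi}"
    by (rule inj_onI) (use cos_inj_pi in \<open>auto simp: complex_eq_iff\<close>)
  then show "infinite (cis ` {0..pi})"
    by (simp add: finite_image_iff infinite_Icc)
next
  show "poly p x = 0" if "x \<in> cis ` {0..pi}" for x
    using that assms by auto
qed

text \<open>Substituting the constant polynomial for y first makes evaluation a composition of two
  ring homomorphisms, so sums and products need no induction.\<close>

lemma eval2_altdef: "eval2 g q = poly (poly g [:snd q:]) (fst q)"
proof (induction g)
  case 0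
  then show ?case by (simp add: eval2_def)
next
  case (pCons a p)
  then show ?case by (simp add: eval2_def map_poly_pCons)
qed

lemma eval2_mult: "eval2 (g * h) q = eval2 g q * eval2 h q"
  by (simp add: eval2_altdef)

lemma eval2_add: "eval2 (g + h) q = eval2 g q + eval2 h q"
  by (simp add: eval2_altdef)

lemma eval2_smult: "eval2 (smult a h) q = poly a (fst q) * eval2 h q"
  by (simp add: eval2_altdef)

lemma eval2_sum:
  "degree g < n \<Longrightarrow> eval2 g q = (\<Sum>j<n. poly (coeff g j) (fst q) * snd q ^ j)"
  unfolding eval2_altdef poly_altdef[of g] poly_sum
  by (intro sum.mono_neutral_cong_left) (auto simp: coeff_eq_0)

section \<open>A sextic curve\<close>

text \<open>The nonzero summands have degrees congruent to 0, 1 and 2 modulo 3, so their leading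
  terms cannot cancel.\<close>

lemma pcompose_cubic_independent:
  fixes q :: "real poly"
  assumes q: "degree q = 3"
    and eq: "pcompose G q + [:0,1:] * pcompose H q + [:0,0,1:] * pcompose K q = 0"
  shows "G = 0 \<and> H = 0 \<and> K = 0"
proof -
  have d: "degree (pcompose F q) = 3 * degree F" for F
    using q by (simp add: degree_pcompose mult.commute)
  have z: "pcompose F q = 0 \<longleftrightarrow> F = 0" for F
    using q pcompose_eq_0[of F q] by auto
  have dH: "degree ([:0,1:] * pcompose H q) = 3 * degree H + 1" if "H \<noteq> 0"
    using that z d by (subst degree_mult_eq) auto
  have dK: "degree ([:0,0,1:] * pcompose K q) = 3 * degree K + 2" if "K \<noteq> 0"
    using that z d by (subst degree_mult_eq) auto
  have K: "K = 0"
  proof (rule ccontr)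
    assume K: "K \<noteq> 0"
    have e: "[:0,0,1:] * pcompose K q = - pcompose G q - [:0,1:] * pcompose H q"
      using eq by (simp add: algebra_simps eq_neg_iff_add_eq_0)
    show False
    proof (cases "H = 0")
      case True
      then have "3 * degree K + 2 = 3 * degree G" using e dK[OF K] d by (simp del: mult_pCons_left)
      then show False by presburger
    next
      case False
      have "degree (- pcompose G q - [:0,1:] * pcompose H q) = max (3 * degree G) (3 * degree H + 1)"
      proof (cases "3 * degree G < 3 * degree H + 1")
        case True
        then show ?thesis using degree_add_eq_right[of "- pcompose G q" "- ([:0,1:] * pcompose H q)"]
          dH[OF False] d by (simp del: mult_pCons_left)
      next
        case F: False
        then have "3 * degree G > 3 * degree H + 1" by presburger
        then show ?thesis using degree_add_eq_left[of "- ([:0,1:] * pcompose H q)" "- pcompose G q"]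
          dH[OF False] d by (simp del: mult_pCons_left)
      qed
      then have "3 * degree K + 2 = max (3 * degree G) (3 * degree H + 1)"
        using dK[OF K] unfolding e by simp
      then have "3 * degree K + 2 = 3 * degree G \<or> 3 * degree K + 2 = 3 * degree H + 1" by (auto simp: max_def split: if_splits)
      then show False by presburger
    qed
  qed
  have H: "H = 0"
  proof (rule ccontr)
    assume H: "H \<noteq> 0"
    have "[:0,1:] * pcompose H q = - pcompose G q"
      using eq K by (simp add: eq_neg_iff_add_eq_0 add.commute)
    then have "3 * degree H + 1 = 3 * degree G" using dH[OF H] d by (simp del: mult_pCons_left)
    then show False by presburger
  qed
  show ?thesis using eq K H z by simp
qed

text \<open>On the curve x = 3c - c^3 and y^2 = (1 - c^2)^3, so this is the independence of 1, y^2,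
  y^4 over the polynomials in x.\<close>

lemma cubic_relation_trivial:
  fixes G0 G1 G2 :: "real poly"
  assumes "\<And>c. \<lbrakk>-1 < c; c < 1\<rbrakk> \<Longrightarrow> poly G0 (3*c - c^3) + poly G1 (3*c - c^3) * (1 - c^2)^3
              + poly G2 (3*c - c^3) * ((1 - c^2)^3)^2 = 0"
  shows "G0 = 0 \<and> G1 = 0 \<and> G2 = 0"
proof -
  define q :: "real poly" where "q = [:0,3,0,-1:]"
  have q: "poly q c = 3*c - c^3" for c by (simp add: q_def power3_eq_cube algebra_simps)
  define X :: "real poly" where "X = [:0,0,1:]"
  have X: "poly X x = x^2" for x by (simp add: X_def power2_eq_square)
  \<comment> \<open>Since $c^3 = 3c - x$, the powers of $Y = (1 - c^2)^3$ reduce to the basis $1, c, c^2$ over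
    the polynomials in $x$; the coefficients of the reduced relation are H0, H1, H2.\<close>
  define H0 where "H0 = G0 + (1 - X) * G1 + (1 + 16 * X + X^2) * G2"
  define H1 where "H1 = [:0,1:] * (3 * G1 - (57 + 6 * X) * G2)"
  define H2 where "H2 = - 3 * G1 + (21 + 15 * X) * G2"
  define L where "L = pcompose H0 q + [:0,1:] * pcompose H1 q + [:0,0,1:] * pcompose H2 q"
  have "poly L c = 0" if c: "c \<in> {-1<..<1}" for c
  proof -
    define x where "x = 3*c - c^3"
    have Y: "(1 - c^2)^3 = 1 - x^2 - 3*c^2 + 3*x*c" unfolding x_def by algebra
    have Y2: "((1 - c^2)^3)^2 = (1 + 16*x^2 + x^4) + (21 + 15*x^2)*c^2 - (57 + 6*x^2)*x*c"
      unfolding x_def by algebra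
    have "0 = poly G0 x + poly G1 x * (1 - x^2 - 3*c^2 + 3*x*c)
       + poly G2 x * ((1 + 16*x^2 + x^4) + (21 + 15*x^2)*c^2 - (57 + 6*x^2)*x*c)"
      using assms[of c] c unfolding x_def[symmetric] Y2 unfolding Y by simp
    also have "\<dots> = poly L c"
      unfolding L_def H0_def H1_def H2_def
      by (simp add: poly_pcompose q X flip: x_def) algebra
    finally show ?thesis by simp
  qed
  then have "L = 0"
    using poly_eq_0_on_infinite[of "{-1<..<1}" L] infinite_Ioo[of "-1::real" 1] by simp
  then have H: "H0 = 0" "H1 = 0" "H2 = 0"
    using pcompose_cubic_independent[of q H0 H1 H2] by (auto simp: L_def q_def)
  \<comment> \<open>Eliminating \<open>G1\<close> between \<open>H1 = 0\<close> and
    \<open>H2 = 0\<close> leaves the factor (21 + 15 X) - (57 + 6 X) = 9 X - 36 on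
    \<open>G2\<close>.\<close>
  have e: "3 * G1 = (57 + 6 * X) * G2" using H(2) by (simp add: H1_def del: mult_pCons_left)
  have "(9 * X - 36) * G2 = 0" using H(3) e by (simp add: H2_def algebra_simps)
  moreover have "9 * X - 36 \<noteq> 0"
  proof
    assume "9 * X - 36 = 0"
    then have "poly (9 * X - 36) 0 = 0" by simp
    then show False by (simp add: X)
  qed
  ultimately have G2: "G2 = 0" by simp
  with e have G1: "G1 = 0" by simp
  with G2 H(1) show ?thesis by (simp add: H0_def)
qed

section \<open>Trigonometric polynomials form an integral domain\<close>

text \<open>These are the Laurent polynomials in \<open>cis \<theta>\<close>; the power with
  exponent \<open>K\<close> clears negative exponents, so ordinary polynomials suffice.\<close>

definition trig_poly :: "(real \<Rightarrow> complex) \<Rightarrow> bool" where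
  "trig_poly h \<longleftrightarrow> (\<exists>K P. \<forall>\<theta>. h \<theta> * cis \<theta> ^ K = poly P (cis \<theta>))"

lemma trig_poly_const: "trig_poly (\<lambda>\<theta>. c)"
  unfolding trig_poly_def by (rule exI[of _ 0], rule exI[of _ "[:c:]"]) simp

lemma trig_poly_add:
  assumes "trig_poly g" "trig_poly h"
  shows "trig_poly (\<lambda>\<theta>. g \<theta> + h \<theta>)"
proof -
  obtain K P L Q where *: "\<And>\<theta>. g \<theta> * cis \<theta> ^ K = poly P (cis \<theta>)"
      "\<And>\<theta>. h \<theta> * cis \<theta> ^ L = poly Q (cis \<theta>)"
    using assms unfolding trig_poly_def by auto
  have "(g \<theta> + h \<theta>) * cis \<theta> ^ (K + L) = poly (P * monom 1 L + Q * monom 1 K) (cis \<theta>)" for \<theta>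
    by (simp add: poly_monom flip: *) (simp add: algebra_simps power_add)
  then show ?thesis unfolding trig_poly_def by blast
qed

lemma trig_poly_mult:
  assumes "trig_poly g" "trig_poly h"
  shows "trig_poly (\<lambda>\<theta>. g \<theta> * h \<theta>)"
proof -
  obtain K P L Q where *: "\<And>\<theta>. g \<theta> * cis \<theta> ^ K = poly P (cis \<theta>)"
      "\<And>\<theta>. h \<theta> * cis \<theta> ^ L = poly Q (cis \<theta>)"
    using assms unfolding trig_poly_def by auto
  have "(g \<theta> * h \<theta>) * cis \<theta> ^ (K + L) = poly (P * Q) (cis \<theta>)" for \<theta>
    by (simp flip: *) (simp add: algebra_simps power_add)
  then show ?thesis unfolding trig_poly_def by blast
qed

lemma trig_poly_power: "trig_poly g \<Longrightarrow> trig_poly (\<lambda>\<theta>. g \<theta> ^ n)"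
  by (induction n) (simp_all add: trig_poly_const trig_poly_mult)

lemma trig_poly_cos: "trig_poly (\<lambda>\<theta>. complex_of_real (cos \<theta>))"
  unfolding trig_poly_def
proof (intro exI allI)
  fix \<theta> :: real
  have "sin \<theta> * sin \<theta> = 1 - cos \<theta> * cos \<theta>"
    using sin_squared_eq[of \<theta>] by (simp add: power2_eq_square)
  then show "complex_of_real (cos \<theta>) * cis \<theta> ^ 1 = poly [:1/2, 0, 1/2:] (cis \<theta>)"
    by (simp add: complex_eq_iff field_simps)
qed

lemma trig_poly_sin: "trig_poly (\<lambda>\<theta>. complex_of_real (sin \<theta>))"
  unfolding trig_poly_def
proof (intro exI allI)
  fix \<theta> :: real
  have "sin \<theta> * sin \<theta> = 1 - cos \<theta> * cos \<theta>"
    using sin_squared_eq[of \<theta>] by (simp add: power2_eq_square)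
  then show "complex_of_real (sin \<theta>) * cis \<theta> ^ 1 = poly [:\<i>/2, 0, -\<i>/2:] (cis \<theta>)"
    by (simp add: complex_eq_iff field_simps)
qed

lemma trig_poly_poly:
  assumes "trig_poly (\<lambda>\<theta>. complex_of_real (X \<theta>))"
  shows "trig_poly (\<lambda>\<theta>. complex_of_real (poly p (X \<theta>)))"
  by (induction p) (simp_all add: trig_poly_const trig_poly_add trig_poly_mult assms)

lemma trig_poly_eval2:
  assumes "trig_poly (\<lambda>\<theta>. complex_of_real (X \<theta>))" "trig_poly (\<lambda>\<theta>. complex_of_real (Y \<theta>))"
  shows "trig_poly (\<lambda>\<theta>. complex_of_real (eval2 g (X \<theta>, Y \<theta>)))"
  unfolding eval2_altdef
  by (induction g) (simp_all add: trig_poly_const trig_poly_add trig_poly_mult trig_poly_poly assms)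

text \<open>Inherited from the absence of zero divisors among complex polynomials. It makes the
  vanishing ideal of a trigonometrically parametrized curve prime.\<close>

lemma trig_poly_mult_eq_0:
  assumes "trig_poly g" "trig_poly h" and "\<And>\<theta>. \<theta> \<in> {-pi..pi} \<Longrightarrow> g \<theta> * h \<theta> = 0"
  shows "(\<forall>\<theta>. g \<theta> = 0) \<or> (\<forall>\<theta>. h \<theta> = 0)"
proof -
  obtain K P L Q where *: "\<And>\<theta>. g \<theta> * cis \<theta> ^ K = poly P (cis \<theta>)"
      "\<And>\<theta>. h \<theta> * cis \<theta> ^ L = poly Q (cis \<theta>)"
    using assms unfolding trig_poly_def by auto
  have "P * Q = 0"
    by (rule poly_eq_0_on_circle) (use assms(3) in \<open>auto simp flip: *\<close>)
  then have "P = 0 \<or> Q = 0" by simp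
  then show ?thesis using * by (metis cis_neq_zero mult_eq_0_iff poly_0 power_not_zero)
qed

section \<open>The sextic and its vanishing ideal\<close>

definition sextic_point :: "real \<Rightarrow> real \<times> real" where
  "sextic_point \<theta> = (3 * cos \<theta> - cos \<theta> ^ 3, sin \<theta> ^ 3)"

definition sextic :: "real poly poly" where
  "sextic = [:[:64, 0, -48, 0, 12, 0, -1:], 0, [:-48, 0, 24, 0, -3:], 0, [:-15, 0, -3:], 0, [:-1:]:]"

lemma eval2_sextic: "eval2 sextic (x, y) = (4 - x^2 - y^2)^3 - 27 * y^4"
  unfolding sextic_def eval2_altdef by simp algebra

lemma sextic_vanishes: "eval2 sextic (sextic_point \<theta>) = 0"
proof -
  define c s where "c = cos \<theta>" and "s = sin \<theta>"
  have "c^2 = 1 - s^2" by (simp add: c_def s_def cos_squared_eq)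
  then have x: "(3*c - c^3)^2 = 4 - 3 * s^4 - s^6" by algebra
  show ?thesis unfolding sextic_point_def eval2_sextic c_def[symmetric] s_def[symmetric] x
    by algebra
qed

lemma degree_sextic: "degree sextic = 6" and lead_coeff_sextic: "lead_coeff sextic = -1"
  by (simp_all add: sextic_def one_pCons)

lemma total_degree_sextic: "total_degree sextic = 6"
proof -
  have le: "i + j \<le> 6" if "coeff (coeff sextic j) i \<noteq> 0" for i j
    using that by (auto simp: sextic_def coeff_pCons split: nat.splits)
  have "coeff (coeff sextic 6) 0 \<noteq> 0" by (simp add: sextic_def numeral_eq_Suc)
  then have "6 \<in> {i + j |i j. coeff (coeff sextic j) i \<noteq> 0}" by force
  moreover have "{i + j |i j. coeff (coeff sextic j) i \<noteq> 0} \<subseteq> {..6}" using le by auto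
  ultimately show ?thesis unfolding total_degree_def
    by (intro Max_eqI) (auto intro: finite_subset)
qed

text \<open>Replacing \<theta> by -\<theta> fixes x and negates y, so the even and odd parts in y
  vanish separately, and each is a relation between 1, y^2 and y^4.\<close>

lemma eq_0_if_vanishes_on_sextic_curve:
  assumes deg: "degree g < 6" and van: "\<And>\<theta>. \<theta> \<in> {-pi..pi} \<Longrightarrow> eval2 g (sextic_point \<theta>) = 0"
  shows "g = 0"
proof -
  let ?g = "\<lambda>j. coeff g j"
  have *: "poly (?g 0) x + poly (?g 2) x * (1 - c^2)^3 + poly (?g 4) x * ((1 - c^2)^3)^2 = 0"
      "poly (?g 1) x + poly (?g 3) x * (1 - c^2)^3 + poly (?g 5) x * ((1 - c^2)^3)^2 = 0"
    if c: "-1 < c" "c < 1" and x: "x = 3*c - c^3" for c x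
  proof -
    define \<theta> where "\<theta> = arccos c"
    have \<theta>: "\<theta> \<in> {-pi..pi}" "cos \<theta> = c"
      using c arccos_lbound[of c] arccos_ubound[of c] pi_gt_zero
      by (auto simp: \<theta>_def intro: order_trans[of _ 0])
    define y where "y = sin \<theta> ^ 3"
    have y2: "y^2 = (1 - c^2)^3"
      unfolding y_def \<theta>(2)[symmetric] sin_squared_eq[symmetric] by (simp flip: power_mult)
    \<comment> \<open>The odd part carries a factor y, which can be cancelled because c = 1 and c =
      -1 are excluded.\<close>
    have "c^2 < 1" using c by (simp add: abs_square_less_1 abs_less_iff)
    then have "(1 - c^2)^3 \<noteq> 0" by simp
    then have y: "y \<noteq> 0" using y2 by auto
    have "eval2 g (x, y) = 0" "eval2 g (x, - y) = 0"
      using van[of \<theta>] van[of "-\<theta>"] \<theta> by (auto simp: sextic_point_def x y_def)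
    then have e: "(\<Sum>j<6. poly (?g j) x * y ^ j) = 0" "(\<Sum>j<6. poly (?g j) x * (-y) ^ j) = 0"
      by (simp_all add: eval2_sum[OF deg])
    have E: "poly (?g 0) x + poly (?g 2) x * y^2 + poly (?g 4) x * (y^2)^2 = 0"
      using e by (simp add: eval_nat_numeral algebra_simps)
    have "y * (poly (?g 1) x + poly (?g 3) x * y^2 + poly (?g 5) x * (y^2)^2) = 0"
      using e by (simp add: eval_nat_numeral algebra_simps)
    then have O: "poly (?g 1) x + poly (?g 3) x * y^2 + poly (?g 5) x * (y^2)^2 = 0"
      using y by simp
    show "poly (?g 0) x + poly (?g 2) x * (1 - c^2)^3 + poly (?g 4) x * ((1 - c^2)^3)^2 = 0"
      "poly (?g 1) x + poly (?g 3) x * (1 - c^2)^3 + poly (?g 5) x * ((1 - c^2)^3)^2 = 0"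
      using E O unfolding y2 .
  qed
  have "?g 0 = 0 \<and> ?g 2 = 0 \<and> ?g 4 = 0" by (rule cubic_relation_trivial) (rule *(1), auto)
  moreover have "?g 1 = 0 \<and> ?g 3 = 0 \<and> ?g 5 = 0" by (rule cubic_relation_trivial) (rule *(2), auto)
  ultimately have "\<forall>j\<in>{0,1,2,3,4,5}. ?g j = 0" by auto
  moreover have "j \<in> {0,1,2,3,4,5}" if "j < 6" for j :: nat using that by auto
  ultimately have "?g j = 0" for j
    using deg coeff_eq_0[of g j] by (cases "j < 6") auto
  then show ?thesis by (simp add: poly_eq_iff)
qed

text \<open>The leading coefficient in y is -1, so pseudo-division multiplies \<open>g\<close> only
  by a sign; the remainder still vanishes on the curve and has degree below 6 in y.\<close>

lemma sextic_dvd: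
  assumes "\<And>\<theta>. \<theta> \<in> {-pi..pi} \<Longrightarrow> eval2 g (sextic_point \<theta>) = 0"
  shows "sextic dvd g"
proof -
  have s0: "sextic \<noteq> 0" using degree_sextic by auto
  obtain q r where qr: "pseudo_divmod g sextic = (q, r)" by fastforce
  define k where "k = Suc (degree g) - degree sextic"
  have 1: "smult ((-1) ^ k) g = sextic * q + r" and 2: "r = 0 \<or> degree r < 6"
    using pseudo_divmod[OF s0 qr] lead_coeff_sextic degree_sextic by (simp_all add: k_def)
  have "eval2 r (sextic_point \<theta>) = 0" if "\<theta> \<in> {-pi..pi}" for \<theta>
  proof -
    have "eval2 (smult ((-1) ^ k) g) (sextic_point \<theta>) = 0" using assms that by (simp add: eval2_smult)
    then show ?thesis unfolding 1 by (simp add: eval2_add eval2_mult sextic_vanishes)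
  qed
  then have "r = 0" using 2 eq_0_if_vanishes_on_sextic_curve by blast
  then have "sextic dvd smult ((-1) ^ k) g" using 1 by simp
  then have "sextic dvd smult ((-1) ^ k) (smult ((-1) ^ k) g)" by (rule dvd_smult)
  then show ?thesis by (simp add: flip: power_add power_mult_distrib)
qed

text \<open>In a factorization one factor vanishes on the whole curve. It is then a multiple of
  \<open>sextic\<close>, and cancelling makes the other factor a unit.\<close>

lemma irreducible_sextic: "irreducible sextic"
proof (rule irreducibleI)
  show "sextic \<noteq> 0" using degree_sextic by auto
  show "\<not> sextic dvd 1"
  proof
    assume "sextic dvd 1"
    then have "degree sextic = 0" by (metis is_unit_poly_iff degree_pCons_0)
    then show False using degree_sextic by simp
  qed
next
  have unit: "h dvd 1" if gh: "sextic = g * h" and "\<forall>\<theta>. eval2 g (sextic_point \<theta>) = 0" for g h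
  proof -
    have "sextic dvd g" using that(2) by (intro sextic_dvd) auto
    then obtain k where "g = sextic * k" by auto
    then have "sextic * (k * h) = sextic * 1" using gh by (simp add: mult.assoc)
    moreover have "sextic \<noteq> 0" using degree_sextic by auto
    ultimately have "k * h = 1" using mult_cancel_left by blast
    then show ?thesis by (metis dvd_triv_right)
  qed
  fix g h assume gh: "sextic = g * h"
  have X: "trig_poly (\<lambda>\<theta>. complex_of_real (3 * cos \<theta> - cos \<theta> ^ 3))"
  proof -
    have "trig_poly (\<lambda>\<theta>. 3 * complex_of_real (cos \<theta>) + (-1) * complex_of_real (cos \<theta>) ^ 3)"
      by (intro trig_poly_add trig_poly_mult trig_poly_const trig_poly_power trig_poly_cos)
    then show ?thesis by simp
  qed
  have Y: "trig_poly (\<lambda>\<theta>. complex_of_real (sin \<theta> ^ 3))"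
    using trig_poly_power[OF trig_poly_sin, of 3] by simp
  have "(\<forall>\<theta>. complex_of_real (eval2 g (sextic_point \<theta>)) = 0) \<or>
        (\<forall>\<theta>. complex_of_real (eval2 h (sextic_point \<theta>)) = 0)"
    unfolding sextic_point_def
    by (rule trig_poly_mult_eq_0[OF trig_poly_eval2[OF X Y] trig_poly_eval2[OF X Y]])
       (use sextic_vanishes in \<open>simp add: sextic_point_def gh eval2_mult flip: of_real_mult\<close>)
  then show "g dvd 1 \<or> h dvd 1"
    using unit[of g h] unit[of h g] gh by (auto simp: mult.commute)
qed

text \<open>Every polynomial vanishing on the curve is a multiple of \<open>sextic\<close>, so the
  closure contains all real zeros of \<open>sextic\<close> without a check that each lies on the
  curve.\<close>

lemma defining_poly_sextic: "defining_poly sextic (sextic_point ` {-pi..pi})"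
  unfolding defining_poly_def
proof (intro conjI irreducible_sextic set_eqI iffI)
  fix q assume "q \<in> zero_set sextic"
  then have q: "eval2 sextic q = 0" by (simp add: zero_set_def)
  show "q \<in> zariski_closure (sextic_point ` {-pi..pi})"
    unfolding zariski_closure_def
  proof (intro CollectI allI impI)
    fix g assume "\<forall>s\<in>sextic_point ` {-pi..pi}. eval2 g s = 0"
    then have "sextic dvd g" by (intro sextic_dvd) auto
    then show "eval2 g q = 0" using q by (auto simp: eval2_mult)
  qed
next
  fix q assume "q \<in> zariski_closure (sextic_point ` {-pi..pi})"
  then show "q \<in> zero_set sextic"
    using sextic_vanishes by (auto simp: zariski_closure_def zero_set_def)
qed

lemma in_R_sextic_curve: "in_R (sextic_point ` {-pi..pi})"
  unfolding in_R_def
proof (intro exI conjI allI)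
  \<comment> \<open>Frequency 2 is kn - 1 for n = 3, k = 1. Here p + p'' = (3/2)(1 - cos 2\<theta>),
    so 3/2 is the least constant term that convexity allows for this amplitude.\<close>
  let ?a = "\<lambda>j::int. if j = 2 then 1/2 else 0 :: real"
  let ?p = "supp_fun 3 1 (3/2) ?a (\<lambda>_. 0)"
  have p: "?p = (\<lambda>\<theta>. 3/2 + 1/2 * cos (2 * \<theta>))"
    by (rule ext) (simp add: supp_fun_def)
  have d: "deriv ?p = (\<lambda>\<theta>. - sin (2 * \<theta>))"
    unfolding p by (rule ext, rule DERIV_imp_deriv) (auto intro!: derivative_eq_intros)
  have dd: "deriv (deriv ?p) \<theta> = - 2 * cos (2 * \<theta>)" for \<theta>
    unfolding d by (rule DERIV_imp_deriv) (auto intro!: derivative_eq_intros)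
  show "3 \<le> (3::nat)" "0 < (3/2::real)" by auto
  show "0 \<le> ?p \<theta> + deriv (deriv ?p) \<theta>" for \<theta>
    unfolding dd unfolding p using cos_le_one[of "2 * \<theta>"] by simp
  have "(?p \<theta> * cos \<theta> - deriv ?p \<theta> * sin \<theta>, ?p \<theta> * sin \<theta> + deriv ?p \<theta> * cos \<theta>) = sextic_point \<theta>" for \<theta>
  proof -
    define c s where "c = cos \<theta>" and "s = sin \<theta>"
    have c: "c^2 + s^2 = 1" by (simp add: c_def s_def)
    have "(3/2 + 1/2 * (2*c^2 - 1)) * c - (-(2 * s * c)) * s = 3*c - c^3" 
      "(3/2 + 1/2 * (2*c^2 - 1)) * s + (-(2 * s * c)) * c = s^3"
      using c by algebra+
    then show ?thesis
      unfolding d unfolding p by (simp add: sextic_point_def sin_double cos_double_cos c_def s_def)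
  qed
  then show "sextic_point ` {-pi..pi} = curve_of ?p" by (simp add: curve_of_def)
qed

lemma not_is_circle_sextic_curve: "\<not> is_circle (sextic_point ` {-pi..pi})"
proof
  assume "is_circle (sextic_point ` {-pi..pi})"
  then obtain x0 y0 r where C: "sextic_point ` {-pi..pi} = {q. (fst q - x0)^2 + (snd q - y0)^2 = r^2}"
    unfolding is_circle_def by auto
  have *: "(fst (sextic_point \<theta>) - x0)^2 + (snd (sextic_point \<theta>) - y0)^2 = r^2" if "\<theta> \<in> {-pi..pi}" for \<theta>
    using C that by blast
  \<comment> \<open>The points (2,0), (-2,0), (0,1), (0,-1) lie on the curve. The symmetric pairs
    force the centre to be the origin, and the distances 2 and 1 differ.\<close>
  have "(2 - x0)^2 + y0^2 = r^2" "(-2 - x0)^2 + y0^2 = r^2" "x0^2 + (1 - y0)^2 = r^2" "x0^2 + (-1 - y0)^2 = r^2"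
    using *[of 0] *[of pi] *[of "pi/2"] *[of "-(pi/2)"] order_trans[of "-(pi/2)" 0 pi]
    by (auto simp: sextic_point_def)
  then show False by (auto simp: power2_eq_square algebra_simps)
qed

section \<open>Polynomials in z and its conjugate\<close>

text \<open>The degree bound sits in the index set, which records that passing from x, y to z and
  its conjugate does not raise the total degree.\<close>

definition conj_poly :: "nat \<Rightarrow> (complex \<Rightarrow> complex) \<Rightarrow> bool" where
  "conj_poly d h \<longleftrightarrow> (\<exists>c. \<forall>z. h z = (\<Sum>(i,j)\<in>{(i,j). i + j \<le> d}. c (i,j) * (z ^ i * cnj z ^ j)))"

lemma finite_sum_le: "finite {(i,j). i + j \<le> (d::nat)}"
  by (rule finite_subset[of _ "{..d} \<times> {..d}"]) auto

lemma conj_poly_monom: "i + j \<le> d \<Longrightarrow> conj_poly d (\<lambda>z. a * (z ^ i * cnj z ^ j))"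
  unfolding conj_poly_def
proof (intro exI allI)
  fix z assume ij: "i + j \<le> d"
  let ?c = "\<lambda>ij. if ij = (i, j) then a else 0"
  have "(\<Sum>(k,l)\<in>{(k,l). k + l \<le> d}. ?c (k,l) * (z ^ k * cnj z ^ l)) =
    (\<Sum>kl\<in>{(k,l). k + l \<le> d}. if kl = (i,j) then a * (z ^ i * cnj z ^ j) else 0)"
    by (rule sum.cong) (auto split: if_splits)
  also have "\<dots> = a * (z ^ i * cnj z ^ j)" using ij by (simp add: finite_sum_le)
  finally show "a * (z ^ i * cnj z ^ j) = (\<Sum>(k,l)\<in>{(k,l). k + l \<le> d}. ?c (k,l) * (z ^ k * cnj z ^ l))"
    by simp
qed

lemma conj_poly_add:
  assumes "conj_poly d g" "conj_poly d h"
  shows "conj_poly d (\<lambda>z. g z + h z)"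
proof -
  obtain a b where "\<And>z. g z = (\<Sum>(i,j)\<in>{(i,j). i + j \<le> d}. a (i,j) * (z ^ i * cnj z ^ j))"
    "\<And>z. h z = (\<Sum>(i,j)\<in>{(i,j). i + j \<le> d}. b (i,j) * (z ^ i * cnj z ^ j))"
    using assms unfolding conj_poly_def by auto
  then have "g z + h z = (\<Sum>(i,j)\<in>{(i,j). i + j \<le> d}. (a (i,j) + b (i,j)) * (z ^ i * cnj z ^ j))" for z
    by (simp add: sum.distrib distrib_right case_prod_unfold)
  then show ?thesis unfolding conj_poly_def
    by (intro exI[of _ "\<lambda>ij. a ij + b ij"]) simp
qed

lemma conj_poly_const: "conj_poly d (\<lambda>z. a)"
  using conj_poly_monom[of 0 0 d a] by simp

lemma conj_poly_sum: "(\<And>x. x \<in> A \<Longrightarrow> conj_poly d (h x)) \<Longrightarrow> conj_poly d (\<lambda>z. \<Sum>x\<in>A. h x z)"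
  by (induction A rule: infinite_finite_induct) (simp_all add: conj_poly_const conj_poly_add)

lemma conj_poly_mult:
  assumes "conj_poly d g" "conj_poly e h"
  shows "conj_poly (d + e) (\<lambda>z. g z * h z)"
proof -
  obtain a b where *: "\<And>z. g z = (\<Sum>(i,j)\<in>{(i,j). i + j \<le> d}. a (i,j) * (z ^ i * cnj z ^ j))"
    "\<And>z. h z = (\<Sum>(i,j)\<in>{(i,j). i + j \<le> e}. b (i,j) * (z ^ i * cnj z ^ j))"
    using assms unfolding conj_poly_def by auto
  have "g z * h z = (\<Sum>p\<in>{(i,j). i + j \<le> d}. \<Sum>q\<in>{(i,j). i + j \<le> e}.
      a p * b q * (z ^ (fst p + fst q) * cnj z ^ (snd p + snd q)))" for z
    unfolding * sum_product by (intro sum.cong) (auto simp: power_add algebra_simps)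
  moreover have "conj_poly (d + e) (\<lambda>z. \<Sum>p\<in>{(i,j). i + j \<le> d}. \<Sum>q\<in>{(i,j). i + j \<le> e}.
      a p * b q * (z ^ (fst p + fst q) * cnj z ^ (snd p + snd q)))"
    by (intro conj_poly_sum conj_poly_monom) auto
  ultimately show ?thesis by simp
qed

lemma conj_poly_power: "conj_poly d h \<Longrightarrow> conj_poly (n * d) (\<lambda>z. h z ^ n)"
proof (induction n)
  case (Suc n)
  then show ?case using conj_poly_mult[of d h "n * d" "\<lambda>z. h z ^ n"] by simp
qed (simp add: conj_poly_const)

lemma conj_poly_mono:
  assumes "conj_poly d h" "d \<le> e"
  shows "conj_poly e h"
  using conj_poly_mult[OF assms(1) conj_poly_const[of "e - d" 1]] assms(2) by simp

lemma conj_poly_Re: "conj_poly 1 (\<lambda>z. complex_of_real (Re (z + a)))"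
proof -
  have *: "complex_of_real (Re (z + a)) =
      (1/2 * (z ^ 1 * cnj z ^ 0) + 1/2 * (z ^ 0 * cnj z ^ 1)) + complex_of_real (Re a)" for z
    by (simp add: complex_eq_iff)
  show ?thesis unfolding *
    by (intro conj_poly_add conj_poly_monom conj_poly_const) auto
qed

lemma conj_poly_Im: "conj_poly 1 (\<lambda>z. complex_of_real (Im (z + a)))"
proof -
  have *: "complex_of_real (Im (z + a)) = (- \<i>/2 * (z ^ 1 * cnj z ^ 0) + \<i>/2 * (z ^ 0 * cnj z ^ 1)) + complex_of_real (Im a)" for z
    by (simp add: complex_eq_iff)
  show ?thesis unfolding *
    by (intro conj_poly_add conj_poly_monom conj_poly_const) auto
qed

text \<open>\<open>Max\<close> bounds only finite sets; finiteness comes from the degrees of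
  \<open>f\<close> and of its coefficients.\<close>

lemma le_total_degree:
  assumes "coeff (coeff f j) i \<noteq> 0"
  shows "i + j \<le> total_degree f"
proof -
  have "{i + j |i j. coeff (coeff f j) i \<noteq> 0} \<subseteq>
      (\<lambda>(j,i). i + j) ` (SIGMA j:{..degree f}. {..degree (coeff f j)})"
  proof safe
    fix i j assume nz: "coeff (coeff f j) i \<noteq> 0"
    then have "coeff f j \<noteq> 0" by auto
    with nz have "(j, i) \<in> (SIGMA j:{..degree f}. {..degree (coeff f j)})"
      by (auto simp: le_degree)
    then show "i + j \<in> (\<lambda>(j,i). i + j) ` (SIGMA j:{..degree f}. {..degree (coeff f j)})"
      by (rule rev_image_eqI) simp
  qed
  then have "finite {i + j |i j. coeff (coeff f j) i \<noteq> 0}"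
    by (rule finite_subset) (intro finite_imageI finite_SigmaI; simp)
  then show ?thesis unfolding total_degree_def using assms by (intro Max_ge) auto
qed

lemma conj_poly_eval2: "conj_poly (total_degree f) (\<lambda>z. complex_of_real (eval2 f (Re (z + a), Im (z + a))))"
proof -
  have *: "complex_of_real (eval2 f (Re (z + a), Im (z + a))) =
    (\<Sum>j\<le>degree f. \<Sum>i\<le>degree (coeff f j). complex_of_real (coeff (coeff f j) i) *
       (complex_of_real (Re (z + a)) ^ i * complex_of_real (Im (z + a)) ^ j))" for z
    by (simp add: eval2_altdef poly_altdef[of f] poly_sum)
       (simp add: poly_altdef sum_distrib_right mult.assoc)
  have "conj_poly (total_degree f) (\<lambda>z. complex_of_real (coeff (coeff f j) i) *
       (complex_of_real (Re (z + a)) ^ i * complex_of_real (Im (z + a)) ^ j))" for i j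
  proof (cases "coeff (coeff f j) i = 0")
    case True
    then show ?thesis by (simp add: conj_poly_const)
  next
    case False
    have "conj_poly (0 + (i * 1 + j * 1)) (\<lambda>z. complex_of_real (coeff (coeff f j) i) *
       (complex_of_real (Re (z + a)) ^ i * complex_of_real (Im (z + a)) ^ j))"
      by (intro conj_poly_mult conj_poly_power conj_poly_const conj_poly_Re conj_poly_Im)
    then show ?thesis by (rule conj_poly_mono) (use le_total_degree[OF False] in simp)
  qed
  then show ?thesis unfolding * by (intro conj_poly_sum)
qed

lemma eval2_nonzero:
  assumes "f \<noteq> 0"
  obtains q where "eval2 f q \<noteq> 0"
proof (rule ccontr)
  assume "\<not> thesis"
  with that have "eval2 f (x, y) = 0" for x y by blast
  then have "poly (poly f [:y:]) x = 0" for x y by (simp add: eval2_altdef)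
  then have "poly f [:y:] = 0" for y using poly_all_0_iff_0 by blast
  moreover have "infinite (range (\<lambda>y::real. [:y:]))"
    by (subst finite_image_iff) (auto simp: inj_def infinite_UNIV_char_0)
  ultimately have "f = 0" by (intro poly_eq_0_on_infinite[of "range (\<lambda>y::real. [:y:])"]) auto
  with assms show False by simp
qed

text \<open>\<open>S\<close> is the support of the expansion in z and its conjugate. The shift
  \<open>a\<close> will absorb the translation caused by the frequency-one terms.\<close>

lemma eval2_conj_expansion:
  fixes a :: complex
  assumes "f \<noteq> 0"
  obtains S c where "finite S" "S \<noteq> {}" "\<And>i j. (i,j) \<in> S \<Longrightarrow> i + j \<le> total_degree f \<and> c (i,j) \<noteq> 0"
    "\<And>z. complex_of_real (eval2 f (Re (z + a), Im (z + a))) = (\<Sum>(i,j)\<in>S. c (i,j) * (z ^ i * cnj z ^ j))"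
proof -
  obtain c where c: "\<And>z. complex_of_real (eval2 f (Re (z + a), Im (z + a))) =
      (\<Sum>(i,j)\<in>{(i,j). i + j \<le> total_degree f}. c (i,j) * (z ^ i * cnj z ^ j))"
    using conj_poly_eval2[of f a] unfolding conj_poly_def by auto
  define S where "S = {ij \<in> {(i,j). i + j \<le> total_degree f}. c ij \<noteq> 0}"
  have S: "complex_of_real (eval2 f (Re (z + a), Im (z + a))) = (\<Sum>(i,j)\<in>S. c (i,j) * (z ^ i * cnj z ^ j))" for z
    unfolding c S_def by (rule sum.mono_neutral_right) (auto simp: finite_sum_le)
  have "S \<noteq> {}"
  proof
    assume "S = {}"
    with S have 0: "eval2 f (Re (z + a), Im (z + a)) = 0" for z by simp
    obtain q where "eval2 f q \<noteq> 0" using eval2_nonzero[OF assms] .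
    with 0[of "Complex (fst q) (snd q) - a"] show False by simp
  qed
  moreover have "finite S" unfolding S_def using finite_sum_le by simp
  ultimately show ?thesis using that S unfolding S_def by auto
qed

section \<open>The Newton polygon of a relation\<close>

text \<open>With s = \<open>cis (-\<theta>)\<close>, z and w are P(s)/s^p and Q(s)/s^q. Multiplying
  the relation by s^M clears denominators; when M is the maximal weight, the constant coefficient
  sees only the top edge.\<close>

lemma edge_polynomial_eq_0:
  fixes P Q :: "complex poly" and z w :: "real \<Rightarrow> complex"
  assumes le: "\<And>i j. (i,j) \<in> S \<Longrightarrow> p * i + q * j \<le> M"
    and z: "\<And>\<theta>. z \<theta> * cis (-\<theta>) ^ p = poly P (cis (-\<theta>))"
    and w: "\<And>\<theta>. w \<theta> * cis (-\<theta>) ^ q = poly Q (cis (-\<theta>))"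
    and 0: "\<And>\<theta>. \<theta> \<in> {-pi..pi} \<Longrightarrow> (\<Sum>(i,j)\<in>S. c (i,j) * (z \<theta> ^ i * w \<theta> ^ j)) = 0"
  shows "(\<Sum>(i,j)\<in>S. monom (c (i,j)) (M - (p * i + q * j)) * (P ^ i * Q ^ j)) = 0"
proof (rule poly_eq_0_on_circle)
  fix \<theta> assume \<theta>: "\<theta> \<in> {-pi..pi}"
  have "poly (\<Sum>(i,j)\<in>S. monom (c (i,j)) (M - (p * i + q * j)) * (P ^ i * Q ^ j)) (cis \<theta>)
      = (\<Sum>(i,j)\<in>S. cis \<theta> ^ M * (c (i,j) * (z (-\<theta>) ^ i * w (-\<theta>) ^ j)))"
    unfolding poly_sum
  proof (rule sum.cong[OF refl], clarify)
    fix i j assume "(i,j) \<in> S"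
    then have "cis \<theta> ^ M = cis \<theta> ^ (M - (p * i + q * j)) * ((cis \<theta> ^ p) ^ i * (cis \<theta> ^ q) ^ j)"
      using le[of i j] by (simp flip: power_mult power_add)
    moreover have "poly P (cis \<theta>) = z (-\<theta>) * cis \<theta> ^ p" "poly Q (cis \<theta>) = w (-\<theta>) * cis \<theta> ^ q"
      using z[of "-\<theta>"] w[of "-\<theta>"] by simp_all
    ultimately show "poly (monom (c (i,j)) (M - (p * i + q * j)) * (P ^ i * Q ^ j)) (cis \<theta>)
       = cis \<theta> ^ M * (c (i,j) * (z (-\<theta>) ^ i * w (-\<theta>) ^ j))"
      by (simp add: poly_monom power_mult_distrib)
  qed
  also have "\<dots> = cis \<theta> ^ M * (\<Sum>(i,j)\<in>S. c (i,j) * (z (-\<theta>) ^ i * w (-\<theta>) ^ j))"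
    by (simp add: sum_distrib_left case_prod_unfold)
  also have "\<dots> = 0" using 0[of "-\<theta>"] \<theta> by simp
  finally show "poly (\<Sum>(i,j)\<in>S. monom (c (i,j)) (M - (p * i + q * j)) * (P ^ i * Q ^ j)) (cis \<theta>) = 0" .
qed

text \<open>First-order expansion of (A + r s^3 + ...)^i (B + r s^3 + ...)^j. The factor
  \<open>A * B\<close> avoids the exponents i - 1 and j - 1.\<close>

lemma coeff_power_mult_low:
  fixes P Q :: "complex poly"
  assumes P: "coeff P 1 = 0" "coeff P 2 = 0" "coeff P 3 = r" and Q: "coeff Q 1 = 0" "coeff Q 2 = 0" "coeff Q 3 = r"
    and A: "coeff P 0 = A" and B: "coeff Q 0 = B"
  shows "coeff (P ^ i * Q ^ j) 1 = 0"
    and "A * B * coeff (P ^ i * Q ^ j) 3 = r * A ^ i * B ^ j * (of_nat i * B + of_nat j * A)"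
proof -
  have c: "coeff (F * G) 1 = coeff F 0 * coeff G 1 + coeff F 1 * coeff G 0"
    "coeff (F * G) 2 = coeff F 0 * coeff G 2 + coeff F 1 * coeff G 1 + coeff F 2 * coeff G 0"
    "coeff (F * G) 3 = coeff F 0 * coeff G 3 + coeff F 1 * coeff G 2 + coeff F 2 * coeff G 1 + coeff F 3 * coeff G 0"
    for F G :: "complex poly"
    by (simp_all add: coeff_mult eval_nat_numeral)
  have pw: "coeff (F ^ n) 1 = 0 \<and> coeff (F ^ n) 2 = 0 \<and> coeff F 0 * coeff (F ^ n) 3 = of_nat n * coeff F 3 * coeff F 0 ^ n"
    if "coeff F 1 = 0" "coeff F 2 = 0" for F :: "complex poly" and n
  proof (induction n)
    case (Suc n)
    then show ?case using that by (simp add: c coeff_0_power algebra_simps del: One_nat_def)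
  qed simp
  note pP = pw[of P i, OF P(1,2)] and pQ = pw[of Q j, OF Q(1,2)]
  show "coeff (P ^ i * Q ^ j) 1 = 0" using pP pQ by (simp add: c del: One_nat_def)
  have "coeff (P ^ i * Q ^ j) 3 = A ^ i * coeff (Q ^ j) 3 + coeff (P ^ i) 3 * B ^ j"
    using pP pQ by (simp add: c coeff_0_power A B del: One_nat_def)
  then have "A * B * coeff (P ^ i * Q ^ j) 3 = A ^ i * A * (B * coeff (Q ^ j) 3) + (A * coeff (P ^ i) 3) * (B * B ^ j)"
    by (simp add: algebra_simps)
  also have "\<dots> = r * A ^ i * B ^ j * (of_nat i * B + of_nat j * A)"
    using pP pQ P Q A B by (simp add: algebra_simps)
  finally show "A * B * coeff (P ^ i * Q ^ j) 3 = r * A ^ i * B ^ j * (of_nat i * B + of_nat j * A)" .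
qed

section \<open>The curve in complex form and its behaviour at infinity\<close>

text \<open>The sum of r and all v_j e^j + w_j e^(-j), multiplied by e^(-N) and read as a polynomial
  in e^(-1). The highest frequency \<open>v N\<close> thus becomes the constant coefficient.\<close>

definition edge_poly :: "nat \<Rightarrow> complex \<Rightarrow> (nat \<Rightarrow> complex) \<Rightarrow> (nat \<Rightarrow> complex) \<Rightarrow> complex poly" where
  "edge_poly N r v w = monom r N + (\<Sum>j=2..N. monom (v j) (N - j) + monom (w j) (N + j))"

lemma poly_edge_poly:
  assumes "e * e' = 1"
  shows "(r + (\<Sum>j=2..N. v j * e ^ j + w j * e' ^ j)) * e' ^ N = poly (edge_poly N r v w) e'"
proof -
  have "e ^ j * e' ^ N = e' ^ (N - j)" if "j \<le> N" for j
  proof -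
    have "e ^ j * e' ^ N = (e * e') ^ j * e' ^ (N - j)"
      using that by (simp add: power_mult_distrib flip: power_add)
    then show ?thesis using assms by simp
  qed
  then show ?thesis
    by (simp add: edge_poly_def poly_sum poly_monom distrib_right sum_distrib_right mult.assoc power_add mult.commute[of "e' ^ N"])
qed

lemma coeff_edge_poly_0:
  assumes "2 \<le> N"
  shows "coeff (edge_poly N r v w) 0 = v N"
proof -
  have "coeff (edge_poly N r v w) 0 = (\<Sum>j=2..N. if j = N then v j else 0)"
    using assms by (auto simp: edge_poly_def coeff_sum simp del: sum.delta sum.delta' intro!: sum.cong)
  also have "\<dots> = v N" using assms by simp
  finally show ?thesis .
qed

lemma coeff_edge_poly_3:
  assumes "v 2 = 0" "w 2 = 0"
  shows "coeff (edge_poly 3 r v w) 1 = 0" "coeff (edge_poly 3 r v w) 2 = 0" "coeff (edge_poly 3 r v w) 3 = r"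
proof -
  have "{2..3::nat} = {2,3}" by auto
  then show "coeff (edge_poly 3 r v w) 1 = 0" "coeff (edge_poly 3 r v w) 2 = 0" "coeff (edge_poly 3 r v w) 3 = r"
    using assms by (simp_all add: edge_poly_def)
qed

text \<open>The point $x + iy$ of the curve whose support function has constant term r, no term of
  frequency one, and j-th complex Fourier coefficient u j.\<close>
definition hedgehog :: "nat \<Rightarrow> real \<Rightarrow> (nat \<Rightarrow> complex) \<Rightarrow> real \<Rightarrow> complex" where
  "hedgehog N r u \<theta> = cis \<theta> * (complex_of_real r +
     (\<Sum>j=2..N. (1 - of_nat j) * u j * cis \<theta> ^ j + (1 + of_nat j) * cnj (u j) * cis (-\<theta>) ^ j))"

text \<open>The outer factor \<open>cis \<theta>\<close> raises the order of z to N + 1 and lowers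
  that of its conjugate to N - 1; these orders are the weights on the Newton polygon.\<close>

lemma hedgehog_edge:
  "hedgehog N r u \<theta> * cis (-\<theta>) ^ (N + 1) =
     poly (edge_poly N r (\<lambda>j. (1 - of_nat j) * u j) (\<lambda>j. (1 + of_nat j) * cnj (u j))) (cis (-\<theta>))"
proof -
  have e: "cis \<theta> * cis (-\<theta>) = 1" by (simp add: cis_mult)
  have "hedgehog N r u \<theta> * cis (-\<theta>) ^ (N + 1) = (cis \<theta> * cis (-\<theta>)) * ((complex_of_real r +
     (\<Sum>j=2..N. (1 - of_nat j) * u j * cis \<theta> ^ j + (1 + of_nat j) * cnj (u j) * cis (-\<theta>) ^ j)) * cis (-\<theta>) ^ N)"
    unfolding hedgehog_def by (simp only: power_add power_one_right mult_ac)
  then show ?thesis unfolding e poly_edge_poly[OF e] by simp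
qed

lemma cnj_hedgehog_edge:
  assumes "1 \<le> N"
  shows "cnj (hedgehog N r u \<theta>) * cis (-\<theta>) ^ (N - 1) =
     poly (edge_poly N r (\<lambda>j. (1 + of_nat j) * u j) (\<lambda>j. (1 - of_nat j) * cnj (u j))) (cis (-\<theta>))"
proof -
  have e: "cis \<theta> * cis (-\<theta>) = 1" by (simp add: cis_mult)
  have "cnj (hedgehog N r u \<theta>) = cis (-\<theta>) * (complex_of_real r +
     (\<Sum>j=2..N. (1 + of_nat j) * u j * cis \<theta> ^ j + (1 - of_nat j) * cnj (u j) * cis (-\<theta>) ^ j))"
    unfolding hedgehog_def by (simp add: cis_cnj add.commute)
  moreover have "cis (-\<theta>) ^ N = cis (-\<theta>) * cis (-\<theta>) ^ (N - 1)"
    using assms by (metis One_nat_def Suc_pred power_Suc less_eq_Suc_le)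
  ultimately have "cnj (hedgehog N r u \<theta>) * cis (-\<theta>) ^ (N - 1) = (complex_of_real r +
     (\<Sum>j=2..N. (1 + of_nat j) * u j * cis \<theta> ^ j + (1 - of_nat j) * cnj (u j) * cis (-\<theta>) ^ j)) * cis (-\<theta>) ^ N"
    by (simp only: mult_ac)
  then show ?thesis unfolding poly_edge_poly[OF e] .
qed

text \<open>The point found lies on the top edge for the weights N + 1, N - 1. Its maximality is
  exported so that two such edges can be compared afterwards.\<close>

lemma hedgehog_relation_top_edge:
  assumes N: "2 \<le> N" "u N \<noteq> 0" and r: "r \<noteq> 0" and N3: "N = 3 \<Longrightarrow> u 2 = 0"
    and S: "finite S" "S \<noteq> {}" "\<And>i j. (i,j) \<in> S \<Longrightarrow> c (i,j) \<noteq> 0"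
    and 0: "\<And>\<theta>. \<theta> \<in> {-pi..pi} \<Longrightarrow>
      (\<Sum>(i,j)\<in>S. c (i,j) * (hedgehog N r u \<theta> ^ i * cnj (hedgehog N r u \<theta>) ^ j)) = 0"
  obtains i j where "(i,j) \<in> S" "3 \<le> j"
    "\<And>i' j'. (i',j') \<in> S \<Longrightarrow> (N + 1) * i' + (N - 1) * j' \<le> (N + 1) * i + (N - 1) * j"
proof -
  note * = that
  define wt where "wt = (\<lambda>(i,j). (N + 1) * i + (N - 1) * j)"
  define M where "M = Max (wt ` S)"
  have le: "(N + 1) * i + (N - 1) * j \<le> M" if "(i,j) \<in> S" for i j
    unfolding M_def using S that by (intro Max_ge) (force simp: wt_def)+
  define T where "T = {ij \<in> S. wt ij = M}"
  have T: "finite T" "T \<subseteq> S" using S by (auto simp: T_def)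
  have "M \<in> wt ` S" unfolding M_def using S by (intro Max_in) auto
  then have "T \<noteq> {}" by (auto simp: T_def)
  define P where "P = edge_poly N r (\<lambda>j. (1 - of_nat j) * u j) (\<lambda>j. (1 + of_nat j) * cnj (u j))"
  define Q where "Q = edge_poly N r (\<lambda>j. (1 + of_nat j) * u j) (\<lambda>j. (1 - of_nat j) * cnj (u j))"
  define A where "A = coeff P 0"
  define B where "B = coeff Q 0"
  have AB: "A = (1 - of_nat N) * u N" "B = (1 + of_nat N) * u N"
    using N by (simp_all add: A_def B_def P_def Q_def coeff_edge_poly_0)
  have "(1::complex) \<noteq> of_nat N" "1 + (of_nat N::complex) \<noteq> 0"
    using N of_nat_eq_1_iff[of N, where 'a=complex] of_nat_neq_0[of N, where 'a=complex] by auto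
  then have nz: "A \<noteq> 0" "B \<noteq> 0" using AB N by auto
  have H: "(\<Sum>(i,j)\<in>S. monom (c (i,j)) (M - ((N + 1) * i + (N - 1) * j)) * (P ^ i * Q ^ j)) = 0"
    by (rule edge_polynomial_eq_0[where z = "hedgehog N r u" and w = "\<lambda>\<theta>. cnj (hedgehog N r u \<theta>)"])
       (use N le 0 in \<open>simp_all add: P_def Q_def hedgehog_edge cnj_hedgehog_edge del: power_Suc One_nat_def add_Suc_right\<close>)
  have sumT: "(\<Sum>(i,j)\<in>S. if wt (i,j) = M then g i j else 0) = (\<Sum>(i,j)\<in>T. g i j)" for g :: "nat \<Rightarrow> nat \<Rightarrow> complex"
    unfolding T_def using S(1) by (intro sum.mono_neutral_cong_right) (auto split: if_splits)
  \<comment> \<open>The constant coefficient of the identity \<open>H\<close>: terms of smaller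
    weight carry a positive power of the variable.\<close>
  have c0: "(\<Sum>(i,j)\<in>T. c (i,j) * (A ^ i * B ^ j)) = 0"
  proof -
    have "0 = coeff (\<Sum>(i,j)\<in>S. monom (c (i,j)) (M - ((N + 1) * i + (N - 1) * j)) * (P ^ i * Q ^ j)) 0"
      unfolding H by simp
    also have "\<dots> = (\<Sum>(i,j)\<in>S. if wt (i,j) = M then c (i,j) * (A ^ i * B ^ j) else 0)"
      unfolding coeff_sum
    proof (rule sum.cong[OF refl], clarify)
      fix i j assume "(i,j) \<in> S"
      then show "coeff (monom (c (i, j)) (M - ((N + 1) * i + (N - 1) * j)) * (P ^ i * Q ^ j)) 0 =
         (if wt (i, j) = M then c (i, j) * (A ^ i * B ^ j) else 0)"
        using le[of i j] by (auto simp: coeff_mult_0 coeff_0_power A_def B_def wt_def)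
    qed
    finally show ?thesis unfolding sumT by simp
  qed
  have wtT: "(N + 1) * i + (N - 1) * j = M" if "(i,j) \<in> T" for i j
    using that by (auto simp: T_def wt_def)
  have "\<exists>i j i' j'. (i,j) \<in> T \<and> (i',j') \<in> T \<and> j < j'"
  proof -
    obtain i j where ij: "(i,j) \<in> T" using \<open>T \<noteq> {}\<close> by auto
    \<comment> \<open>A single term on the edge would leave
      \<open>c (i,j) * (A ^ i * B ^ j)\<close>, which is nonzero.\<close>
    have "T \<noteq> {(i,j)}" using c0 nz S(3) ij T by auto
    then obtain i' j' where ij': "(i',j') \<in> T" "(i',j') \<noteq> (i,j)" using ij by auto
    have "j \<noteq> j'"
    proof
      assume "j = j'"
      then have "(N + 1) * i = (N + 1) * i'" using wtT[OF ij] wtT[OF ij'(1)] by simp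
      then have "i = i'" by (simp only: mult_cancel1) simp
      then show False using \<open>j = j'\<close> ij' by simp
    qed
    then show ?thesis using ij ij' by (meson nat_neq_iff)
  qed
  then obtain i j i' j' where ij: "(i,j) \<in> T" "(i',j') \<in> T" "j < j'" by blast
  have top: thesis if "(i,j) \<in> T" "3 \<le> j" for i j
  proof (rule *)
    show "(i,j) \<in> S" "3 \<le> j" using that T by auto
    show "(N + 1) * i' + (N - 1) * j' \<le> (N + 1) * i + (N - 1) * j" if "(i',j') \<in> S" for i' j'
      using le[OF that] wtT[OF \<open>(i,j) \<in> T\<close>] by simp
  qed
  \<comment> \<open>This turns N - 1 into K + 1 and so avoids truncated subtraction.\<close>
  obtain K where K: "N = K + 2" using N by (metis add.commute le_Suc_ex)
  define d where "d = j' - j"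
  have d: "j' = j + d" "0 < d" using ij by (auto simp: d_def)
  have eq: "(K + 3) * i = (K + 3) * i' + (K + 1) * d"
    using wtT[OF ij(1)] wtT[OF ij(2)] d by (simp add: K algebra_simps)
  have "i' < i"
  proof (rule ccontr)
    assume "\<not> i' < i"
    then have "(K + 3) * i \<le> (K + 3) * i'" by (intro mult_le_mono2) simp
    then show False using eq d by simp
  qed
  define x where "x = i - i'"
  have x: "i = i' + x" "0 < x" using \<open>i' < i\<close> by (auto simp: x_def)
  have eq: "(K + 3) * x = (K + 1) * d" using eq by (simp add: x algebra_simps)
  show thesis
  proof (cases "3 \<le> j'")
    case True
    then show thesis using top ij(2) by blast
  next
    case False
    then have j': "d = 1 \<or> (d = 2 \<and> j = 0)" using d by auto
    \<comment> \<open>In (K + 3) x = (K + 1) d with d at most 2, any x of at least 2 makes the left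
      side too large, and x = 1 leaves only d = 2, K = 1.\<close>
    have "d = 2 \<and> K = 1 \<and> x = 1"
    proof (cases "x = 1")
      case True
      then show ?thesis using eq j' by auto
    next
      case False
      then have "(K + 3) * 2 \<le> (K + 3) * x" using x by (intro mult_le_mono2) simp
      moreover have "(K + 1) * d \<le> (K + 1) * 2" using j' by (intro mult_le_mono2) auto
      ultimately show ?thesis using eq by simp
    qed
    then have N3': "N = 3" and jj: "j = 0" "j' = 2" using K j' d by auto
    have u2: "u 2 = 0" using N3 N3' by simp
    \<comment> \<open>The first coefficient past the leading one, which is a multiple of r, forces a second
      linear relation on the top edge, so that two points are not enough.\<close>
    have P: "coeff P 1 = 0" "coeff P 2 = 0" "coeff P 3 = r" and Q: "coeff Q 1 = 0" "coeff Q 2 = 0" "coeff Q 3 = r"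
      unfolding P_def Q_def N3' using u2 by (simp_all add: coeff_edge_poly_3 del: One_nat_def)
    note low = coeff_power_mult_low[OF P Q A_def[symmetric] B_def[symmetric]]
    have BA: "B = - 2 * A" using AB N3' by simp
    have "0 = A * B * coeff (\<Sum>(i,j)\<in>S. monom (c (i,j)) (M - ((N + 1) * i + (N - 1) * j)) * (P ^ i * Q ^ j)) 3"
      unfolding H by simp
    also have "\<dots> = (\<Sum>(i,j)\<in>S. if wt (i,j) = M then c (i,j) * (A * B * coeff (P ^ i * Q ^ j) 3) else 0)"
      unfolding coeff_sum sum_distrib_left
    proof (rule sum.cong[OF refl], clarify)
      fix k l assume kl: "(k,l) \<in> S"
      \<comment> \<open>All weights 4k + 2l are even, so the gap to M is 0, 2 or at least 4. A gap
        of 2 would need coefficient 1 of the product, which vanishes; a larger gap does not reach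
        coefficient 3.\<close>
      have "even M" using wtT[OF ij(1)] N3' by auto
      then have "even (M - ((N + 1) * k + (N - 1) * l))" using N3' by simp
      moreover have even: "e = 0 \<or> e = 2 \<or> 3 < e" if "even e" for e :: nat using that by presburger
      ultimately have "M - ((N + 1) * k + (N - 1) * l) = 0 \<or> M - ((N + 1) * k + (N - 1) * l) = 2
        \<or> 3 < M - ((N + 1) * k + (N - 1) * l)" by (intro even)
      then show "A * B * coeff (monom (c (k, l)) (M - ((N + 1) * k + (N - 1) * l)) * (P ^ k * Q ^ l)) 3 =
         (if wt (k, l) = M then c (k, l) * (A * B * coeff (P ^ k * Q ^ l) 3) else 0)"
      proof (elim disjE)
        assume 1: "M - ((N + 1) * k + (N - 1) * l) = 0"
        then have "wt (k,l) = M" using le[OF kl] by (simp add: wt_def)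
        then show ?thesis unfolding 1 by (simp add: coeff_monom_mult)
      next
        assume 2: "M - ((N + 1) * k + (N - 1) * l) = 2"
        then have "wt (k,l) \<noteq> M" by (auto simp: wt_def)
        then show ?thesis unfolding 2 using low(1)[of k l] by (simp add: coeff_monom_mult)
      next
        assume 3: "3 < M - ((N + 1) * k + (N - 1) * l)"
        then have "wt (k,l) \<noteq> M" by (auto simp: wt_def)
        then show ?thesis using 3 by (simp add: coeff_monom_mult)
      qed
    qed
    also have "\<dots> = (\<Sum>(k,l)\<in>T. c (k,l) * (A * B * coeff (P ^ k * Q ^ l) 3))" by (rule sumT)
    \<comment> \<open>From B = -2A and M = 4k + 2l one gets kB + lA = A (2l - M/2). The part with M
      then drops out by \<open>c0\<close>, leaving a sum weighted by l.\<close>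
    also have "\<dots> = (\<Sum>(k,l)\<in>T. r * A * (2 * of_nat l - of_nat M / 2) * (c (k,l) * (A ^ k * B ^ l)))"
    proof (rule sum.cong[OF refl], clarify)
      fix k l assume "(k,l) \<in> T"
      then have "M = 4 * k + 2 * l" using wtT[of k l] N3' by simp
      then show "c (k,l) * (A * B * coeff (P ^ k * Q ^ l) 3) = r * A * (2 * of_nat l - of_nat M / 2) * (c (k,l) * (A ^ k * B ^ l))"
        unfolding low(2) by (simp add: BA algebra_simps)
    qed
    also have "\<dots> = 2 * r * A * (\<Sum>(k,l)\<in>T. of_nat l * (c (k,l) * (A ^ k * B ^ l)))
        - r * A * of_nat M / 2 * (\<Sum>(k,l)\<in>T. c (k,l) * (A ^ k * B ^ l))"
      unfolding sum_distrib_left sum_subtractf[symmetric]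
      by (intro sum.cong) (auto simp: algebra_simps)
    finally have s: "(\<Sum>(k,l)\<in>T. of_nat l * (c (k,l) * (A ^ k * B ^ l))) = 0"
      using c0 r nz by simp
    show thesis
    proof (rule ccontr)
      assume "\<not> thesis"
      \<comment> \<open>If l < 3 on the whole edge, parity excludes l = 1 and the weight l kills l =
        0, so only the nonzero term at (i',2) survives.\<close>
      then have l3: "l < 3" if "(k,l) \<in> T" for k l using top[OF that] by force
      have "(\<Sum>(k,l)\<in>T. of_nat l * (c (k,l) * (A ^ k * B ^ l))) =
         (\<Sum>kl\<in>{(i',2)}. of_nat (snd kl) * (c kl * (A ^ fst kl * B ^ snd kl)))"
      proof (rule sum.mono_neutral_cong_right[OF T(1)])
        show "{(i',2)} \<subseteq> T" using ij jj by simp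
        show "\<forall>kl\<in>T - {(i', 2)}. (case kl of (k,l) \<Rightarrow> of_nat l * (c (k,l) * (A ^ k * B ^ l))) = 0"
        proof
          fix kl assume "kl \<in> T - {(i',2)}"
          then obtain k l where kl: "(k,l) \<in> T" "(k,l) \<noteq> (i',2)" and [simp]: "kl = (k,l)"
            by (cases kl) auto
          have "4 * k + 2 * l = 4 * i' + 4" using wtT[OF kl(1)] wtT[OF ij(2)] N3' jj by simp
          moreover have "k \<noteq> i' \<or> l \<noteq> 2" using kl(2) by auto
          ultimately have "l = 0" using l3[OF kl(1)] by presburger
          then show "(case kl of (k,l) \<Rightarrow> of_nat l * (c (k,l) * (A ^ k * B ^ l))) = 0" by simp
        qed
      qed auto
      then have "c (i',2) * (A ^ i' * B ^ 2) = 0" using s by simp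
      then show False using S(3)[of i' 2] ij jj T nz by auto
    qed
  qed
qed

text \<open>The top edge is found for the relation and for its conjugate, where the weights are
  exchanged. The second weighting favours j, so its maximal point has j at least as large as the
  first, and both its exponents reach 3.\<close>

lemma hedgehog_relation_degree:
  assumes N: "2 \<le> N" "u N \<noteq> 0" and r: "r \<noteq> 0" and N3: "N = 3 \<Longrightarrow> u 2 = 0"
    and S: "finite S" "S \<noteq> {}" "\<And>i j. (i,j) \<in> S \<Longrightarrow> c (i,j) \<noteq> 0"
    and 0: "\<And>\<theta>. \<theta> \<in> {-pi..pi} \<Longrightarrow>
      (\<Sum>(i,j)\<in>S. c (i,j) * (hedgehog N r u \<theta> ^ i * cnj (hedgehog N r u \<theta>) ^ j)) = 0"
  obtains i j where "(i,j) \<in> S" "6 \<le> i + j"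
proof -
  obtain i1 j1 where 1: "(i1,j1) \<in> S" "3 \<le> j1"
    "\<And>i j. (i,j) \<in> S \<Longrightarrow> (N + 1) * i + (N - 1) * j \<le> (N + 1) * i1 + (N - 1) * j1"
    using hedgehog_relation_top_edge[OF N r N3 S 0] by blast
  have cnj0: "(\<Sum>(i,j)\<in>prod.swap ` S. cnj (c (j,i)) * (hedgehog N r u \<theta> ^ i * cnj (hedgehog N r u \<theta>) ^ j)) = 0"
    if "\<theta> \<in> {-pi..pi}" for \<theta>
  proof -
    have "(\<Sum>(i,j)\<in>prod.swap ` S. cnj (c (j,i)) * (hedgehog N r u \<theta> ^ i * cnj (hedgehog N r u \<theta>) ^ j))
      = cnj (\<Sum>(i,j)\<in>S. c (i,j) * (hedgehog N r u \<theta> ^ i * cnj (hedgehog N r u \<theta>) ^ j))"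
      by (subst sum.reindex) (auto simp: case_prod_unfold mult_ac)
    then show ?thesis using 0[OF that] by simp
  qed
  obtain i2 j2 where 2: "(i2,j2) \<in> S" "3 \<le> i2"
    "\<And>i j. (i,j) \<in> S \<Longrightarrow> (N + 1) * j + (N - 1) * i \<le> (N + 1) * j2 + (N - 1) * i2"
  proof (rule hedgehog_relation_top_edge[where S = "prod.swap ` S" and c = "\<lambda>ij. cnj (c (prod.swap ij))" and N = N and u = u and r = r])
    fix j i assume *: "(j,i) \<in> prod.swap ` S" "3 \<le> i"
      "\<And>i' j'. (i',j') \<in> prod.swap ` S \<Longrightarrow> (N + 1) * i' + (N - 1) * j' \<le> (N + 1) * j + (N - 1) * i"
    show thesis
    proof (rule that[of i j])
      show "(i,j) \<in> S" using *(1) by auto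
      show "(N + 1) * l + (N - 1) * k \<le> (N + 1) * j + (N - 1) * i" if "(k,l) \<in> S" for k l
        using *(3)[of l k] that by force
    qed (fact *(2))
  qed (use N r N3 S cnj0 in auto)
  \<comment> \<open>Otherwise, with y = j1 - j2 and x = i2 - i1, the two maximality conditions read
    (N + 1) x \<le> (N - 1) y and (N + 1) y \<le> (N - 1) x, which contradict each other for
    positive y.\<close>
  have "j1 \<le> j2"
  proof (rule ccontr)
    assume "\<not> j1 \<le> j2"
    then obtain y where y: "j1 = j2 + y" "0 < y" by (metis less_imp_add_positive not_le)
    obtain K where K: "N = K + 2" using N by (metis add.commute le_Suc_ex)
    have a: "(K + 3) * i2 \<le> (K + 3) * i1 + (K + 1) * y" using 1(3)[OF 2(1)] by (simp add: K y algebra_simps)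
    have b: "(K + 3) * y + (K + 1) * i1 \<le> (K + 1) * i2" using 2(3)[OF 1(1)] by (simp add: K y algebra_simps)
    have "i1 < i2"
    proof (rule ccontr)
      assume "\<not> i1 < i2"
      then have "(K + 1) * i2 \<le> (K + 1) * i1" by (intro mult_le_mono2) simp
      moreover have "0 < (K + 3) * y" using y by simp
      ultimately show False using b by linarith
    qed
    then obtain x where x: "i2 = i1 + x" by (metis less_imp_add_positive)
    show False using a b y by (simp add: x algebra_simps)
  qed
  then show thesis using that[OF 2(1)] 1(2) 2(2) by simp
qed

section \<open>Support functions\<close>

text \<open>Each summand is u_j e^(ij\<theta>) plus its conjugate. Frequency one is kept apart as
  \<open>k\<close> because it only translates the curve.\<close>

definition trig_support :: "nat \<Rightarrow> real \<Rightarrow> complex \<Rightarrow> (nat \<Rightarrow> complex) \<Rightarrow> real \<Rightarrow> real" where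
  "trig_support N r k u \<theta> = r + Re k * cos \<theta> + Im k * sin \<theta>
     + (\<Sum>j=2..N. 2 * Re (u j) * cos (of_nat j * \<theta>) - 2 * Im (u j) * sin (of_nat j * \<theta>))"

lemma deriv_trig_support:
  "deriv (trig_support N r k u) \<theta> = - Re k * sin \<theta> + Im k * cos \<theta>
     + (\<Sum>j=2..N. of_nat j * (- 2 * Re (u j) * sin (of_nat j * \<theta>) - 2 * Im (u j) * cos (of_nat j * \<theta>)))"
  unfolding trig_support_def
  by (rule DERIV_imp_deriv) (auto intro!: derivative_eq_intros sum.cong simp: algebra_simps)

text \<open>The point is e^(i\<theta>) (p + i p'). Differentiation multiplies e^(ij\<theta>) by ij,
  which yields the factors 1 - j and 1 + j, and turns frequency one into k e^(-i\<theta>).\<close>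

lemma hedgehog_param:
  fixes N :: nat and r :: real and k :: complex and u :: "nat \<Rightarrow> complex"
  defines "p \<equiv> trig_support N r k u"
  shows "Complex (p \<theta> * cos \<theta> - deriv p \<theta> * sin \<theta>) (p \<theta> * sin \<theta> + deriv p \<theta> * cos \<theta>) = hedgehog N r u \<theta> + k"
proof -
  have "Complex (p \<theta> * cos \<theta> - deriv p \<theta> * sin \<theta>) (p \<theta> * sin \<theta> + deriv p \<theta> * cos \<theta>)
     = cis \<theta> * Complex (p \<theta>) (deriv p \<theta>)"
    by (simp add: complex_eq_iff algebra_simps)
  also have "Complex (p \<theta>) (deriv p \<theta>) = r + k * cis (-\<theta>) +
     (\<Sum>j=2..N. (1 - of_nat j) * u j * cis \<theta> ^ j + (1 + of_nat j) * cnj (u j) * cis (-\<theta>) ^ j)"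
  proof -
    have "cis \<phi> ^ j = Complex (cos (of_nat j * \<phi>)) (sin (of_nat j * \<phi>))" for \<phi> j
      by (simp add: Complex.DeMoivre complex_eq_iff)
    then have summand: "(1 - of_nat j) * u j * cis \<theta> ^ j + (1 + of_nat j) * cnj (u j) * cis (-\<theta>) ^ j =
      Complex (2 * Re (u j) * cos (of_nat j * \<theta>) - 2 * Im (u j) * sin (of_nat j * \<theta>))
        (of_nat j * (- 2 * Re (u j) * sin (of_nat j * \<theta>) - 2 * Im (u j) * cos (of_nat j * \<theta>)))" for j
      by (simp add: complex_eq_iff algebra_simps)
    show ?thesis
      unfolding p_def deriv_trig_support summand
      by (simp add: complex_eq_iff trig_support_def)
  qed
  also have "cis \<theta> * \<dots> = cis \<theta> * cis (-\<theta>) * k + hedgehog N r u \<theta>"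
    by (simp add: hedgehog_def algebra_simps)
  finally show ?thesis by (simp add: cis_mult)
qed

text \<open>The summand with index 0 has frequencies 1 and -1, which merge into \<open>k\<close>;
  the minus sign at \<open>b (-1)\<close> is that of sin(-\<theta>).\<close>

lemma supp_fun_eq_trig_support:
  fixes a b :: "int \<Rightarrow> real"
  assumes n: "3 \<le> n"
  defines "k \<equiv> Complex (a 1 + a (-1)) (b 1 - b (-1))"
    and "u \<equiv> \<lambda>j. if j mod n = 1 \<or> j mod n = n - 1 then Complex (a (int j)) (- b (int j)) / 2 else 0"
  shows "supp_fun n m r a b = trig_support (m * n + 1) r k u"
proof
  fix \<theta>
  define g where "g j = 2 * Re (u j) * cos (of_nat j * \<theta>) - 2 * Im (u j) * sin (of_nat j * \<theta>)" for j
  show "supp_fun n m r a b \<theta> = trig_support (m * n + 1) r k u \<theta>"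
  proof (induction m)
    case 0
    show ?case by (simp add: supp_fun_def trig_support_def k_def algebra_simps)
  next
    case (Suc m)
    define l where "l = Suc m * n"
    have l: "l \<ge> 3" "m * n + n = l" using n by (auto simp: l_def)
    \<comment> \<open>Passing to \<open>Suc m\<close> adds a block of n frequencies, of which only
      the two neighbours of \<open>l\<close> carry a coefficient.\<close>
    have "{2..Suc m * n + 1} = {2..m * n + 1} \<union> {m * n + 2..l + 1}" using n by (auto simp: l_def)
    then have "sum g {2..Suc m * n + 1} = sum g {2..m * n + 1} + sum g {m * n + 2..l + 1}"
      by (simp add: sum.union_disjoint)
    also have "sum g {m * n + 2..l + 1} = sum g {l - 1, l + 1}"
    proof (rule sum.mono_neutral_right)
      show "{l - 1, l + 1} \<subseteq> {m * n + 2..l + 1}" using n by (auto simp: l_def)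
      show "\<forall>j\<in>{m * n + 2..l + 1} - {l - 1, l + 1}. g j = 0"
      proof
        fix j assume j: "j \<in> {m * n + 2..l + 1} - {l - 1, l + 1}"
        have "j mod n \<noteq> 1 \<and> j mod n \<noteq> n - 1"
        proof (cases "j = l")
          case True
          then show ?thesis using n by (simp add: l_def)
        next
          case False
          then have "m * n + 2 \<le> j" "j < l - 1" using j by auto
          define i where "i = j - m * n"
          have i: "j = m * n + i" "2 \<le> i" "i < n - 1"
            using \<open>m * n + 2 \<le> j\<close> \<open>j < l - 1\<close> l by (auto simp: i_def)
          then have "j mod n = i" by simp
          then show ?thesis using i by simp
        qed
        then show "g j = 0" by (simp add: g_def u_def)
      qed
    qed simp
    also have "\<dots> = g (l - 1) + g (l + 1)" by simp
    also have "g (l - 1) = a (int l - 1) * cos (of_int (int l - 1) * \<theta>) + b (int l - 1) * sin (of_int (int l - 1) * \<theta>)"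
    proof -
      have "l - 1 = m * n + (n - 1)" using l n by simp
      then have "(l - 1) mod n = (n - 1) mod n" by (simp only: mod_mult_self3)
      then have "(l - 1) mod n = n - 1" using n by simp
      moreover have "int (l - 1) = int l - 1" "real (l - 1) = of_int (int l - 1)" using l by auto
      ultimately show ?thesis by (simp add: g_def u_def)
    qed
    also have "g (l + 1) = a (int l + 1) * cos (of_int (int l + 1) * \<theta>) + b (int l + 1) * sin (of_int (int l + 1) * \<theta>)"
    proof -
      have "(l + 1) mod n = 1" using n by (simp add: l_def mod_Suc)
      then show ?thesis by (simp add: g_def u_def add.commute)
    qed
    finally have "trig_support (Suc m * n + 1) r k u \<theta> = trig_support (m * n + 1) r k u \<theta>
      + (a (int l - 1) * cos (of_int (int l - 1) * \<theta>) + b (int l - 1) * sin (of_int (int l - 1) * \<theta>)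
      + (a (int l + 1) * cos (of_int (int l + 1) * \<theta>) + b (int l + 1) * sin (of_int (int l + 1) * \<theta>)))"
      by (simp add: trig_support_def g_def)
    moreover have "supp_fun n (Suc m) r a b \<theta> = supp_fun n m r a b \<theta>
      + (a (int l - 1) * cos (of_int (int l - 1) * \<theta>) + b (int l - 1) * sin (of_int (int l - 1) * \<theta>)
      + (a (int l + 1) * cos (of_int (int l + 1) * \<theta>) + b (int l + 1) * sin (of_int (int l + 1) * \<theta>)))"
      unfolding supp_fun_def l_def by (subst sum.atLeast0_atMost_Suc) (simp only: add_ac)
    ultimately show ?case using Suc.IH by simp
  qed
qed

lemma curve_of_trig_support:
  "curve_of (trig_support N r k u) = (\<lambda>\<theta>. (Re (hedgehog N r u \<theta> + k), Im (hedgehog N r u \<theta> + k))) ` {-pi..pi}"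
  unfolding curve_of_def hedgehog_param[symmetric] by simp

lemma trig_support_cong:
  assumes "N \<le> L" "\<And>j. N < j \<Longrightarrow> j \<le> L \<Longrightarrow> u j = 0"
  shows "trig_support L r k u = trig_support N r k u"
proof -
  have "(\<Sum>j=2..L. 2 * Re (u j) * cos (of_nat j * \<theta>) - 2 * Im (u j) * sin (of_nat j * \<theta>)) =
    (\<Sum>j=2..N. 2 * Re (u j) * cos (of_nat j * \<theta>) - 2 * Im (u j) * sin (of_nat j * \<theta>))" for \<theta>
    using assms by (intro sum.mono_neutral_right) auto
  then show ?thesis by (intro ext) (simp add: trig_support_def)
qed

text \<open>For N = 1 the sum over higher frequencies is empty and the curve is r e^(i\<theta>) +
  k.\<close>

lemma is_circle_hedgehog:
  assumes "0 < r"
  shows "is_circle (curve_of (trig_support 1 r k u))"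
  unfolding is_circle_def curve_of_trig_support
proof (intro exI conjI set_eqI iffI)
  fix q assume "q \<in> (\<lambda>\<theta>. (Re (hedgehog 1 r u \<theta> + k), Im (hedgehog 1 r u \<theta> + k))) ` {-pi..pi}"
  then show "q \<in> {q. (fst q - Re k)^2 + (snd q - Im k)^2 = r^2}"
    by (auto simp: hedgehog_def power_mult_distrib simp flip: distrib_right)
next
  fix q assume "q \<in> {q. (fst q - Re k)^2 + (snd q - Im k)^2 = r^2}"
  then have q: "((fst q - Re k) / r)^2 + ((snd q - Im k) / r)^2 = 1"
    using assms by (simp add: power_divide flip: add_divide_distrib)
  then obtain \<theta> where "-pi \<le> \<theta>" "\<theta> \<le> pi" "(fst q - Re k) / r = cos \<theta>" "(snd q - Im k) / r = sin \<theta>"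
    using sincos_total_2pi_le[OF q] sincos_principal_value by (metis less_imp_le)
  then show "q \<in> (\<lambda>\<theta>. (Re (hedgehog 1 r u \<theta> + k), Im (hedgehog 1 r u \<theta> + k))) ` {-pi..pi}"
    using assms by (intro image_eqI[of _ _ \<theta>]) (auto simp: hedgehog_def field_simps prod_eq_iff)
qed (fact assms)

section \<open>The lower bound for curves that are not circles\<close>

lemma total_degree_ge_6:
  assumes "in_R C" "\<not> is_circle C" "f \<noteq> 0" and van: "\<And>q. q \<in> C \<Longrightarrow> eval2 f q = 0"
  shows "6 \<le> total_degree f"
proof -
  obtain n m r a b where n: "3 \<le> n" and r: "0 < r" and C: "C = curve_of (supp_fun n m r a b)"
    using assms(1) unfolding in_R_def by blast
  define k where "k = Complex (a 1 + a (-1)) (b 1 - b (-1))"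
  define u where "u = (\<lambda>j. if j mod n = 1 \<or> j mod n = n - 1 then Complex (a (int j)) (- b (int j)) / 2 else 0)"
  define J where "J = {j \<in> {2..m * n + 1}. u j \<noteq> 0}"
  have C: "C = curve_of (trig_support (m * n + 1) r k u)"
    unfolding C k_def u_def supp_fun_eq_trig_support[OF n] ..
  have "J \<noteq> {}"
  proof
    assume "J = {}"
    then have "trig_support (m * n + 1) r k u = trig_support 1 r k u"
      by (intro trig_support_cong) (auto simp: J_def)
    then show False using assms(2) is_circle_hedgehog[OF r] C by simp
  qed
  define N where "N = Max J"
  have fin: "finite J" by (simp add: J_def)
  have "N \<in> J" unfolding N_def using fin \<open>J \<noteq> {}\<close> by (rule Max_in)
  then have N: "2 \<le> N" "u N \<noteq> 0" "N \<le> m * n + 1" by (auto simp: J_def)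
  have "u j = 0" if "N < j" "j \<le> m * n + 1" for j
    using that Max_ge[OF fin, of j] N unfolding N_def[symmetric] by (force simp: J_def)
  then have C: "C = curve_of (trig_support N r k u)"
    unfolding C using trig_support_cong[of N "m * n + 1" u r k] N(3) by simp
  \<comment> \<open>The frequency 3 is congruent to 1 or -1 modulo n only for n = 4, and 2 is
    neither modulo 4.\<close>
  have N3: "u 2 = 0" if "N = 3"
  proof -
    have "3 mod n = 1 \<or> 3 mod n = n - 1" using N(2) that by (auto simp: u_def split: if_splits)
    moreover have "3 mod n = (if n = 3 then 0 else 3)" using n by auto
    ultimately have "n = 4" using n by (auto split: if_splits)
    then show ?thesis by (simp add: u_def)
  qed
  obtain S c where S: "finite S" "S \<noteq> {}" "\<And>i j. (i,j) \<in> S \<Longrightarrow> i + j \<le> total_degree f \<and> c (i,j) \<noteq> 0"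
    "\<And>z. complex_of_real (eval2 f (Re (z + k), Im (z + k))) = (\<Sum>(i,j)\<in>S. c (i,j) * (z ^ i * cnj z ^ j))"
    using eval2_conj_expansion[OF assms(3), of k] by blast
  have "(\<Sum>(i,j)\<in>S. c (i,j) * (hedgehog N r u \<theta> ^ i * cnj (hedgehog N r u \<theta>) ^ j)) = 0" if "\<theta> \<in> {-pi..pi}" for \<theta>
  proof -
    have "(Re (hedgehog N r u \<theta> + k), Im (hedgehog N r u \<theta> + k)) \<in> C"
      unfolding C curve_of_trig_support using that by blast
    then show ?thesis using van S(4)[of "hedgehog N r u \<theta>"] by simp
  qed
  then obtain i j where "(i,j) \<in> S" "6 \<le> i + j"
    using hedgehog_relation_degree[of N u r S c] N r N3 S by blast
  then show ?thesis using S(3) by force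
qed

theorem theorem2p10:
  shows "(\<exists>C f. in_R C \<and> \<not> is_circle C \<and> defining_poly f C \<and> total_degree f = 6) \<and>
         (\<forall>C f. in_R C \<and> \<not> is_circle C \<and> defining_poly f C \<longrightarrow> total_degree f \<ge> 6)"
proof (intro conjI allI impI)
  show "\<exists>C f. in_R C \<and> \<not> is_circle C \<and> defining_poly f C \<and> total_degree f = 6"
    using in_R_sextic_curve not_is_circle_sextic_curve defining_poly_sextic total_degree_sextic by blast
next
  fix C f assume *: "in_R C \<and> \<not> is_circle C \<and> defining_poly f C"
  then have "f \<noteq> 0" and zs: "zero_set f = zariski_closure C" by (auto simp: defining_poly_def)
  have "C \<subseteq> zero_set f" unfolding zs zariski_closure_def by auto
  then show "6 \<le> total_degree f"
    using * \<open>f \<noteq> 0\<close> by (intro total_degree_ge_6[of C]) (auto simp: zero_set_def)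
qed

end
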